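(* For the SGUM based random access control game there exists a unique socially-aware Nash equilibrium, in which for every user $i\in\mathcal N$ the access probability is $$q_i^{SNE}=\frac{\sum_{j\in\mathcal I_i^+}w_{ij}+1+c_i-\sqrt{\Bigl(\sum_{j\in\mathcal I_i^+}w_{ij}+1+c_i\Bigr)^2-4c_i}}{2c_i}.$$
   Context: Users $\mathcal N=\{1,\dots,N\}$; user $i$ is a link with transmitter $T_i$ and receiver $R_i$. Identifying links with users, $\mathcal I_i^+\subseteq\mathcal N\setminus\{i\}$ is the set of users whose receivers are interfered with by $T_i$, and $\mathcal I_i^-\subseteq\mathcal N\setminus\{i\}$ is the set of users whose transmitters cause interference to $R_i$; thus $j\in\mathcal I_i^+$ iff $i\in\mathcal I_j^-$. User $i$ contends with probability $q_i\in[0,1]$, and the probability that it obtains the transmission opportunity is $b_i(q_i,q_{-i})=q_i\prod_{j\in\mathcal I_i^-}(1-q_j)$. Individual utility: $U_i(q_i,q_{-i})=\log(z_ib_i(q_i,q_{-i}))-c_iq_i$ with constants $z_i>0$, $c_i>0$ (with $\log0=-\infty$). $w_{ij}\in[0,1]$ is the strength of user $i$'s social tie towards user $j$, with $w_{ij}=0$ if there is no social tie. Social group utility: $S_i=U_i+\sum_{j\in\mathcal N_i^s}w_{ij}U_j$, where $\mathcal N_i^s\subseteq\mathcal N\setminus\{i\}$ is the set of users having a social tie with $i$ (with $0\cdot(-\infty)=0$). In the SGUM based random access control game, user $i$ chooses $q_i$ to maximize $S_i$. A socially-aware Nash equilibrium (SNE) is a profile in which each $q_i$ maximizes $S_i$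 over its strategy set $[0,1]$ given the other users' strategies.
   Formalization: Uniqueness is claimed only for users whose social group utility in the equilibrium is not −∞; literal uniqueness fails, e.g. for three mutually interfering users without ties, (1,1,1) and (1,1,0) are both SNEs. Existence with the formula is unconditional. *)

theory Defs
  imports "HOL-Analysis.Analysis"
begin

(* The logarithm of a nonnegative real, with log 0 = -\<infinity> (the library's ln has ln 0 = 0). *)
definition elog :: "real \<Rightarrow> ereal" where
  "elog x = (if x > 0 then ereal (ln x) else - \<infinity>)"

(* Iminus i is the set of users whose transmitters interfere with the receiver of user i. *)
definition access_prob :: "(nat \<Rightarrow> nat set) \<Rightarrow> (nat \<Rightarrow> real) \<Rightarrow> nat \<Rightarrow> real" where
  "access_prob Iminus q i = q i * (\<Prod>j\<in>Iminus i. 1 - q j)"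

definition utility ::
  "(nat \<Rightarrow> nat set) \<Rightarrow> (nat \<Rightarrow> real) \<Rightarrow> (nat \<Rightarrow> real) \<Rightarrow> (nat \<Rightarrow> real) \<Rightarrow> nat \<Rightarrow> ereal" where
  "utility Iminus z c q i = elog (z i * access_prob Iminus q i) - ereal (c i * q i)"

(* Ns i is the set of users with whom user i has a social tie.  In type ereal,
   0 * (-\<infinity>) = 0, and no summand below can be +\<infinity> when w \<ge> 0. *)
definition social_group_utility ::
  "(nat \<Rightarrow> nat set) \<Rightarrow> (nat \<Rightarrow> nat set) \<Rightarrow> (nat \<Rightarrow> nat \<Rightarrow> real) \<Rightarrow> (nat \<Rightarrow> real) \<Rightarrow> (nat \<Rightarrow> real)
    \<Rightarrow> (nat \<Rightarrow> real) \<Rightarrow> nat \<Rightarrow> ereal" where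
  "social_group_utility Iminus Ns w z c q i =
     utility Iminus z c q i + (\<Sum>j\<in>Ns i. ereal (w i j) * utility Iminus z c q j)"

(* The users are 1, ..., N; the values of a profile q outside {1..N} are irrelevant. *)
definition is_SNE ::
  "nat \<Rightarrow> (nat \<Rightarrow> nat set) \<Rightarrow> (nat \<Rightarrow> nat set) \<Rightarrow> (nat \<Rightarrow> nat \<Rightarrow> real) \<Rightarrow> (nat \<Rightarrow> real) \<Rightarrow> (nat \<Rightarrow> real)
    \<Rightarrow> (nat \<Rightarrow> real) \<Rightarrow> bool" where
  "is_SNE N Iminus Ns w z c q \<longleftrightarrow>
     (\<forall>i\<in>{1..N}. q i \<in> {0..1} \<and>
        (\<forall>x\<in>{0..1}. social_group_utility Iminus Ns w z c (q(i := x)) i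
                     \<le> social_group_utility Iminus Ns w z c q i))"

definition sne_prob ::
  "(nat \<Rightarrow> nat set) \<Rightarrow> (nat \<Rightarrow> nat \<Rightarrow> real) \<Rightarrow> (nat \<Rightarrow> real) \<Rightarrow> nat \<Rightarrow> real" where
  "sne_prob Iplus w c i =
     ((\<Sum>j\<in>Iplus i. w i j) + 1 + c i - sqrt (((\<Sum>j\<in>Iplus i. w i j) + 1 + c i)\<^sup>2 - 4 * c i)) / (2 * c i)"

lemma social_group_utility_eq_minf:
  assumes "finite (Iminus i)" and "j \<in> Iminus i" and "q j = 1"
    and "finite (Ns i)" and "\<And>k. k \<in> Ns i \<Longrightarrow> w i k \<ge> 0"
  shows "social_group_utility Iminus Ns w z c q i = - \<infinity>"
proof -
  have "(\<Prod>k\<in>Iminus i. 1 - q k) = 0"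
    using assms(1-3) by (auto intro: prod_zero)
  then have U: "utility Iminus z c q i = - \<infinity>"
    by (simp add: utility_def elog_def access_prob_def)
  have "ereal (w i k) * utility Iminus z c q k \<noteq> \<infinity>" if "k \<in> Ns i" for k
    using assms(5)[OF that] by (auto simp: utility_def elog_def)
  then have "(\<Sum>k\<in>Ns i. ereal (w i k) * utility Iminus z c q k) \<noteq> \<infinity>"
    by (simp add: sum_Pinfty)
  then show ?thesis
    by (simp add: social_group_utility_def U)
qed

(* A profile in which every user suffers interference from a user with access probability 1
   is an SNE for a trivial reason: every social group utility is -\<infinity>, whatever its owner plays.
   Such profiles violate uniqueness of the SNE. *)
lemma is_SNE_of_blocked:
  assumes "\<And>i. i \<in> {1..N} \<Longrightarrow> Iminus i \<subseteq> {1..N} - {i}"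
    and "\<And>i. i \<in> {1..N} \<Longrightarrow> Ns i \<subseteq> {1..N} - {i}"
    and "\<And>i j. i \<in> {1..N} \<Longrightarrow> j \<in> {1..N} \<Longrightarrow> w i j \<ge> 0"
    and "\<And>i. i \<in> {1..N} \<Longrightarrow> q i \<in> {0..1}"
    and "\<And>i. i \<in> {1..N} \<Longrightarrow> \<exists>j\<in>Iminus i. q j = 1"
  shows "is_SNE N Iminus Ns w z c q"
  unfolding is_SNE_def
proof (intro ballI conjI)
  fix i assume i: "i \<in> {1..N}"
  show "q i \<in> {0..1}" by (rule assms(4)[OF i])
  fix x :: real assume "x \<in> {0..1}"
  obtain j where j: "j \<in> Iminus i" "q j = 1" using assms(5)[OF i] by blast
  have "j \<noteq> i" using j assms(1)[OF i] by blast
  have "social_group_utility Iminus Ns w z c (q(i := x)) i = - \<infinity>"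
  proof (rule social_group_utility_eq_minf[where j = j])
    show "finite (Iminus i)" "finite (Ns i)"
      using assms(1,2)[OF i] finite_subset by blast+
    show "(q(i := x)) j = 1" using j \<open>j \<noteq> i\<close> by simp
    show "w i k \<ge> 0" if "k \<in> Ns i" for k
      using that assms(2)[OF i] assms(3)[OF i] by blast
  qed (use j in simp)
  then show "social_group_utility Iminus Ns w z c (q(i := x)) i
               \<le> social_group_utility Iminus Ns w z c q i" by simp
qed

lemma SNE_not_unique:
  fixes z c :: "nat \<Rightarrow> real"
  defines "Iminus \<equiv> \<lambda>i. {1..3} - {i}"
  shows "\<exists>q q'. is_SNE 3 Iminus (\<lambda>_. {}) (\<lambda>_ _. 0) z c q
              \<and> is_SNE 3 Iminus (\<lambda>_. {}) (\<lambda>_ _. 0) z c q' \<and> q 3 \<noteq> q' 3"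
proof (intro exI conjI)
  let ?q = "\<lambda>_::nat. 1::real" and ?q' = "(\<lambda>_::nat. 1::real)(3 := 0)"
  show "is_SNE 3 Iminus (\<lambda>_. {}) (\<lambda>_ _. 0) z c ?q"
  proof (rule is_SNE_of_blocked)
    fix i :: nat assume "i \<in> {1..3}"
    have "(if i = 1 then 2 else 1) \<in> Iminus i" by (auto simp: Iminus_def)
    then show "\<exists>j\<in>Iminus i. ?q j = 1" by blast
  qed (auto simp: Iminus_def)
  show "is_SNE 3 Iminus (\<lambda>_. {}) (\<lambda>_ _. 0) z c ?q'"
  proof (rule is_SNE_of_blocked)
    fix i :: nat assume "i \<in> {1..3}"
    have "(if i = 1 then 2 else 1) \<in> Iminus i" by (auto simp: Iminus_def)
    moreover have "?q' (if i = 1 then 2 else 1) = 1" by simp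
    ultimately show "\<exists>j\<in>Iminus i. ?q' j = 1" by blast
  qed (auto simp: Iminus_def)
  show "?q 3 \<noteq> ?q' 3" by simp
qed

end

theory Submission
  imports Defs
begin

text \<open>
  If the social group utility of user \<open>i\<close> is finite, then as a function of the own access probability \<open>t\<close>
  it equals \<open>ln t + A ln (1 - t) - c t\<close> up to a constant, where \<open>A\<close> is the sum of the tie strengths
  towards the users in \<open>Iplus i\<close>. This function is strictly concave. Clearing denominators in
  the stationarity condition \<open>1 / t - A / (1 - t) = c\<close> gives a quadratic equation whose smaller root lies
  in \<open>(0, 1]\<close> and is the maximizer (it is the corner \<open>1\<close> only if \<open>A = 0\<close>). That root does not depend on the other users, so it is a strictly dominant choice whenever the utility is finite.
\<close>

section \<open>Maximizing the one-variable payoff\<close>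

definition payoff :: "real \<Rightarrow> real \<Rightarrow> real \<Rightarrow> real" where
  "payoff A c t = ln t + A * ln (1 - t) - c * t"

definition opt_prob :: "real \<Rightarrow> real \<Rightarrow> real" where
  "opt_prob A c = (A + 1 + c - sqrt ((A + 1 + c)\<^sup>2 - 4 * c)) / (2 * c)"

text \<open>With \<open>B = A + 1 + c\<close> and \<open>s\<close> the root of the discriminant,
  \<open>s < B\<close> gives positivity and \<open>s \<ge> B - 2 * c\<close> gives the bound 1. The
  two roots of the quadratic have product \<open>1 / c\<close>, so the smaller one has square at
  most \<open>1 / c\<close>; this bound yields \<open>c \<le> 1\<close> at a corner optimum.\<close>

lemma opt_prob:
  fixes A c :: real
  assumes A: "A \<ge> 0" and c: "c > 0"
  shows opt_prob_quadratic: "c * (opt_prob A c)\<^sup>2 + 1 = (A + 1 + c) * opt_prob A c"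
    and opt_prob_pos: "opt_prob A c > 0"
    and opt_prob_le_1: "opt_prob A c \<le> 1"
    and opt_prob_square_le: "c * (opt_prob A c)\<^sup>2 \<le> 1"
proof -
  define B s where "B = A + 1 + c" and "s = sqrt (B\<^sup>2 - 4 * c)"
  define p where "p = opt_prob A c"
  \<comment> \<open>A square plus a nonnegative term: the root is real and at least
    \<open>B - 2 * c\<close>.\<close>
  have D: "B\<^sup>2 - 4 * c = (B - 2 * c)\<^sup>2 + 4 * c * A"
    by (simp add: B_def power2_eq_square algebra_simps)
  have D0: "B\<^sup>2 - 4 * c \<ge> 0" unfolding D using A c by simp
  have s2: "s\<^sup>2 = B\<^sup>2 - 4 * c" and s0: "s \<ge> 0"
    using D0 by (simp_all add: s_def)
  have B0: "B > 0" using A c by (simp add: B_def)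
  have sB: "s < B" by (rule power2_less_imp_less) (use s2 c B0 in auto)
  have cp: "2 * c * p = B - s"
    using c by (simp add: p_def opt_prob_def B_def s_def)
  have p: "p = (B - s) / (2 * c)" using cp c by (simp add: field_simps)
  have "4 * c * (c * p\<^sup>2 + 1) = (2 * c * p)\<^sup>2 + 4 * c"
    by (simp add: power2_eq_square algebra_simps)
  also have "\<dots> = 2 * B * (B - s)"
    using s2 unfolding cp by (simp add: power2_eq_square algebra_simps)
  also have "\<dots> = 4 * c * (B * p)" unfolding cp[symmetric] by simp
  finally have quad: "c * p\<^sup>2 + 1 = B * p" using c by simp
  then show "c * (opt_prob A c)\<^sup>2 + 1 = (A + 1 + c) * opt_prob A c"
    by (simp add: p_def B_def)
  show "opt_prob A c > 0" using sB c p by (simp add: p_def)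
  have "B - 2 * c \<le> s"
    by (rule power2_le_imp_le) (use s2 D s0 A c in auto)
  then have "2 * c * p \<le> 2 * c * 1" using cp by simp
  then show "opt_prob A c \<le> 1" using c by (simp add: p_def)
  \<comment> \<open>Since \<open>s\<^sup>2 = B\<^sup>2 - 4 * c\<close>, this says
    \<open>B * (B - s) \<le> 4 * c\<close>, that is \<open>B * p \<le> 2\<close>; the quadratic
    equation then bounds \<open>c * p\<^sup>2\<close>.\<close>
  have "s * s \<le> B * s" using sB s0 by (intro mult_right_mono) auto
  then have "B * (B - s) \<le> 4 * c"
    using s2 by (simp add: power2_eq_square algebra_simps)
  then have "2 * c * (B * p) \<le> 2 * c * 2" unfolding cp[symmetric] by (simp add: mult.left_commute)
  then have "B * p \<le> 2" using c by simp
  then show "c * (opt_prob A c)\<^sup>2 \<le> 1" using quad by (simp add: p_def)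
qed

lemma opt_prob_eq_1D:
  assumes "A \<ge> 0" "c > 0" "opt_prob A c = 1"
  shows "A = 0" "c \<le> 1"
  using opt_prob_quadratic[OF assms(1,2)] opt_prob_square_le[OF assms(1,2)] assms(3) by auto

text \<open>Both logarithms are bounded by their tangents at the optimum, where the slopes sum to zero.
  At a corner optimum \<open>opt_prob A c = 1\<close> the logarithmic cost of interference is absent.\<close>
lemma payoff_less_opt_prob:
  assumes A: "A \<ge> 0" and c: "c > 0" and y: "0 < y" "y \<le> 1" "y = 1 \<Longrightarrow> A = 0"
    and neq: "y \<noteq> opt_prob A c"
  shows "payoff A c y < payoff A c (opt_prob A c)"
proof -
  define p where "p = opt_prob A c"
  have p: "0 < p" "p \<le> 1" using opt_prob_pos opt_prob_le_1 A c by (simp_all add: p_def)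
  have "ln (y / p) < y / p - 1"
    using ln_le_minus_one[of "y / p"] ln_eq_minus_one[of "y / p"] y p neq
    by (fastforce simp: p_def)
  then have ly: "ln y - ln p < (y - p) / p"
    using y p by (simp add: ln_div diff_divide_distrib)
  have "payoff A c y - payoff A c p < 0"
  proof (cases "p = 1")
    case True
    then have A0: "A = 0" and c1: "c \<le> 1"
      using opt_prob_eq_1D[OF A c] by (simp_all add: p_def)
    have "payoff A c y - payoff A c p < (y - 1) * (1 - c)"
      using ly True A0 by (simp add: payoff_def algebra_simps)
    also have "\<dots> \<le> 0" using c1 y by (simp add: mult_nonpos_nonneg)
    finally show ?thesis .
  next
    case False
    then have p1: "p < 1" using p by simp
    have "A * (ln (1 - y) - ln (1 - p)) \<le> A * (- (y - p) / (1 - p))"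
    proof (cases "y = 1")
      case False
      then have "ln ((1 - y) / (1 - p)) \<le> (1 - y) / (1 - p) - 1"
        using y p1 by (intro ln_le_minus_one) simp
      also have "\<dots> = - (y - p) / (1 - p)" using p1 by (simp add: field_simps)
      finally have "ln (1 - y) - ln (1 - p) \<le> - (y - p) / (1 - p)"
        using False y p1 by (simp add: ln_div)
      then show ?thesis using A by (rule mult_left_mono)
    qed (use y in simp)
    then have "payoff A c y - payoff A c p
        < (y - p) / p + A * (- (y - p) / (1 - p)) - c * (y - p)"
      using ly by (simp add: payoff_def algebra_simps)
    \<comment> \<open>Over the common denominator, the sum of the slopes has the quadratic of
      \<open>opt_prob\<close> as its numerator.\<close>
    also have "\<dots> = (y - p) * (c * p\<^sup>2 + 1 - (A + 1 + c) * p) / (p * (1 - p))"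
      using p p1 by (simp add: field_simps power2_eq_square)
    also have "\<dots> = 0" using opt_prob_quadratic[OF A c] by (simp add: p_def)
    finally show ?thesis .
  qed
  then show ?thesis by (simp add: p_def)
qed

section \<open>Finite utilities as real numbers\<close>

definition unblocked :: "(nat \<Rightarrow> nat set) \<Rightarrow> (nat \<Rightarrow> real) \<Rightarrow> nat \<Rightarrow> bool" where
  "unblocked Iminus q j \<longleftrightarrow> q j > 0 \<and> (\<forall>k\<in>Iminus j. q k < 1)"

text \<open>The logarithm of the access probability is split into a sum, so that a unilateral
  deviation changes single summands. It represents \<open>utility\<close> only where
  \<open>unblocked\<close> holds; elsewhere the convention \<open>ln 0 = 0\<close>
  intervenes.\<close>

definition real_utility ::
  "(nat \<Rightarrow> nat set) \<Rightarrow> (nat \<Rightarrow> real) \<Rightarrow> (nat \<Rightarrow> real) \<Rightarrow> (nat \<Rightarrow> real) \<Rightarrow> nat \<Rightarrow> real" where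
  "real_utility Iminus z c q j = ln (z j) + ln (q j) + (\<Sum>k\<in>Iminus j. ln (1 - q k)) - c j * q j"

lemma utility_eq:
  assumes fin: "finite (Iminus j)" and z: "z j > 0" and qj: "q j \<ge> 0"
    and q: "\<And>k. k \<in> Iminus j \<Longrightarrow> q k \<le> 1"
  shows "utility Iminus z c q j =
    (if unblocked Iminus q j then ereal (real_utility Iminus z c q j) else - \<infinity>)"
proof (cases "unblocked Iminus q j")
  case True
  then have pos: "q j > 0" "(\<Prod>k\<in>Iminus j. 1 - q k) > 0"
    by (auto simp: unblocked_def intro!: prod_pos)
  have "ln (\<Prod>k\<in>Iminus j. 1 - q k) = (\<Sum>k\<in>Iminus j. ln (1 - q k))"
    using True by (intro ln_prod) (auto simp: unblocked_def fin)
  then show ?thesis using True pos z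
    by (simp add: utility_def elog_def access_prob_def real_utility_def ln_mult_pos)
next
  case False
  then have "q j = 0 \<or> (\<exists>k\<in>Iminus j. 1 - q k = 0)"
    using q qj by (force simp: unblocked_def)
  then have "access_prob Iminus q j = 0"
    using fin by (auto simp: access_prob_def)
  then show ?thesis using False by (simp add: utility_def elog_def)
qed

lemma real_utility_upd_self:
  assumes "i \<notin> Iminus i"
  shows "real_utility Iminus z c (q(i := y)) i =
    real_utility Iminus z c q i + (ln y - c i * y) - (ln (q i) - c i * q i)"
proof -
  have "(\<Sum>k\<in>Iminus i. ln (1 - (q(i := y)) k)) = (\<Sum>k\<in>Iminus i. ln (1 - q k))"
    using assms by (intro sum.cong) auto
  then show ?thesis by (simp add: real_utility_def)
qed

lemma real_utility_upd_other:
  assumes "finite (Iminus j)" "j \<noteq> i"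
  shows "real_utility Iminus z c (q(i := y)) j =
    real_utility Iminus z c q j + (if i \<in> Iminus j then ln (1 - y) - ln (1 - q i) else 0)"
proof -
  have "(\<Sum>k\<in>Iminus j. ln (1 - (q(i := y)) k)) =
      (\<Sum>k\<in>Iminus j. ln (1 - q k) + (if k = i then ln (1 - y) - ln (1 - q i) else 0))"
    by (intro sum.cong) auto
  then show ?thesis using assms by (simp add: real_utility_def sum.distrib)
qed

section \<open>Social group utility under unilateral deviations\<close>

locale access_game =
  fixes N :: nat
    and Iplus Iminus Ns :: "nat \<Rightarrow> nat set"
    and w :: "nat \<Rightarrow> nat \<Rightarrow> real"
    and z c :: "nat \<Rightarrow> real"
  assumes Iplus: "i \<in> {1..N} \<Longrightarrow> Iplus i \<subseteq> {1..N} - {i}"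
    and Iminus: "i \<in> {1..N} \<Longrightarrow> Iminus i \<subseteq> {1..N} - {i}"
    and Iplus_iff: "i \<in> {1..N} \<Longrightarrow> j \<in> {1..N} \<Longrightarrow> j \<in> Iplus i \<longleftrightarrow> i \<in> Iminus j"
    and z_pos: "i \<in> {1..N} \<Longrightarrow> z i > 0"
    and c_pos: "i \<in> {1..N} \<Longrightarrow> c i > 0"
    and Ns: "i \<in> {1..N} \<Longrightarrow> Ns i \<subseteq> {1..N} - {i}"
    and w_nonneg: "i \<in> {1..N} \<Longrightarrow> j \<in> {1..N} - {i} \<Longrightarrow> w i j \<ge> 0"
    and w_eq_0: "i \<in> {1..N} \<Longrightarrow> j \<in> {1..N} - {i} \<Longrightarrow> j \<notin> Ns i \<Longrightarrow> w i j = 0"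
begin

abbreviation S :: "(nat \<Rightarrow> real) \<Rightarrow> nat \<Rightarrow> ereal" where
  "S \<equiv> social_group_utility Iminus Ns w z c"

abbreviation tie :: "nat \<Rightarrow> real" where
  "tie i \<equiv> \<Sum>j\<in>Iplus i. w i j"

text \<open>Ties of strength 0 impose no condition because \<open>0 * (-\<infinity>) = 0\<close> in
  \<open>ereal\<close>.\<close>

definition group_unblocked :: "(nat \<Rightarrow> real) \<Rightarrow> nat \<Rightarrow> bool" where
  "group_unblocked q i \<longleftrightarrow>
    unblocked Iminus q i \<and> (\<forall>j\<in>Ns i. w i j > 0 \<longrightarrow> unblocked Iminus q j)"

lemma finite_sets:
  assumes "i \<in> {1..N}"
  shows "finite (Iplus i)" "finite (Iminus i)" "finite (Ns i)"
  using Iplus[OF assms] Iminus[OF assms] Ns[OF assms] by (auto intro: finite_subset)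

lemma tie_nonneg:
  assumes i: "i \<in> {1..N}"
  shows "tie i \<ge> 0"
  using Iplus[OF i] w_nonneg[OF i] by (intro sum_nonneg) blast

lemma tie_eq_0_iff:
  assumes i: "i \<in> {1..N}"
  shows "tie i = 0 \<longleftrightarrow> (\<forall>j\<in>Iplus i. w i j = 0)"
  using Iplus[OF i] w_nonneg[OF i] by (intro sum_nonneg_eq_0_iff finite_sets[OF i]) blast

text \<open>No summand can be \<infinity>, so a single summand -\<infinity>, from user
  \<open>i\<close> or from a positively weighted tie, forces the whole sum to -\<infinity>.\<close>

lemma S_eq:
  assumes i: "i \<in> {1..N}" and q: "\<And>k. k \<in> {1..N} \<Longrightarrow> q k \<in> {0..1}"
  shows "S q i = (if group_unblocked q i
    then ereal (real_utility Iminus z c q i + (\<Sum>j\<in>Ns i. w i j * real_utility Iminus z c q j))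
    else - \<infinity>)"
proof -
  have U: "utility Iminus z c q j =
      (if unblocked Iminus q j then ereal (real_utility Iminus z c q j) else - \<infinity>)"
    if "j \<in> {1..N}" for j
  proof (rule utility_eq)
    show "q k \<le> 1" if "k \<in> Iminus j" for k
      using that Iminus[OF \<open>j \<in> {1..N}\<close>] q[of k] by auto
  qed (use that finite_sets z_pos q in auto)
  have jN: "j \<in> {1..N}" and w0: "w i j \<ge> 0" if "j \<in> Ns i" for j
    using that Ns[OF i] by (auto intro!: w_nonneg[OF i])
  show ?thesis
  proof (cases "group_unblocked q i")
    case True
    have "(\<Sum>j\<in>Ns i. ereal (w i j) * utility Iminus z c q j) =
        (\<Sum>j\<in>Ns i. ereal (w i j * real_utility Iminus z c q j))"
    proof (rule sum.cong[OF refl])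
      fix j assume j: "j \<in> Ns i"
      show "ereal (w i j) * utility Iminus z c q j = ereal (w i j * real_utility Iminus z c q j)"
      proof (cases "w i j = 0")
        case False
        then have "unblocked Iminus q j" using True j w0[OF j] by (auto simp: group_unblocked_def)
        then show ?thesis using U[OF jN[OF j]] by simp
      qed (simp add: zero_ereal_def[symmetric])
    qed
    then show ?thesis
      using True U[OF i] by (simp add: social_group_utility_def group_unblocked_def)
  next
    case False
    define T where "T = (\<lambda>j. ereal (w i j) * utility Iminus z c q j)"
    have T: "T j \<noteq> \<infinity>" if "j \<in> Ns i" for j
      using w0[OF that] by (auto simp: T_def utility_def elog_def)
    have sum_T: "sum T F \<noteq> \<infinity>" if "F \<subseteq> Ns i" for F
      using that T by (auto simp: sum_Pinfty)
    show ?thesis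
    proof (cases "unblocked Iminus q i")
      case True
      then obtain j where j: "j \<in> Ns i" "w i j > 0" "\<not> unblocked Iminus q j"
        using False by (auto simp: group_unblocked_def)
      have "T j = - \<infinity>" using j U[OF jN[OF j(1)]] by (simp add: T_def)
      then have "sum T (Ns i) = - \<infinity>"
        using sum.remove[OF finite_sets(3)[OF i] j(1), of T] sum_T[of "Ns i - {j}"] by auto
      then show ?thesis
        using True False U[OF i] by (simp add: social_group_utility_def T_def)
    next
      case nb: False
      then show ?thesis
        using False U[OF i] sum_T[of "Ns i"] by (simp add: social_group_utility_def T_def)
    qed
  qed
qed

text \<open>Playing 1 blocks every user in \<open>Iplus i\<close>, so finiteness of the group
  utility rules out positive ties to them.\<close>

lemma group_unblocked_own:
  assumes i: "i \<in> {1..N}" and u: "group_unblocked q i"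
  shows "q i > 0" and "q i = 1 \<Longrightarrow> tie i = 0"
proof -
  show "q i > 0" using u by (simp add: group_unblocked_def unblocked_def)
  assume q1: "q i = 1"
  have "w i j = 0" if j: "j \<in> Iplus i" for j
  proof (rule ccontr)
    assume w: "w i j \<noteq> 0"
    have jN: "j \<in> {1..N} - {i}" using j Iplus[OF i] by auto
    then have "j \<in> Ns i" "w i j > 0" using w w_eq_0[OF i] w_nonneg[OF i jN] by auto
    then have "unblocked Iminus q j" using u by (simp add: group_unblocked_def)
    moreover have "i \<in> Iminus j" using Iplus_iff[OF i] jN j by auto
    ultimately show False using q1 by (auto simp: unblocked_def)
  qed
  then show "tie i = 0" by simp
qed

lemma group_unblocked_upd:
  assumes i: "i \<in> {1..N}" and u: "group_unblocked q i"
    and y: "0 < y" "y \<le> 1" "y = 1 \<Longrightarrow> tie i = 0"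
  shows "group_unblocked (q(i := y)) i"
  unfolding group_unblocked_def
proof (intro conjI ballI impI)
  show "unblocked Iminus (q(i := y)) i"
    using u y Iminus[OF i] by (auto simp: group_unblocked_def unblocked_def)
next
  fix j assume j: "j \<in> Ns i" and w: "w i j > 0"
  have jN: "j \<in> {1..N} - {i}" using j Ns[OF i] by auto
  have "y < 1" if "i \<in> Iminus j"
  proof -
    have "j \<in> Iplus i" using that jN Iplus_iff[OF i] by auto
    then have "tie i \<noteq> 0" using w tie_eq_0_iff[OF i] by auto
    then show ?thesis using y by fastforce
  qed
  then show "unblocked Iminus (q(i := y)) j"
    using u j w jN by (auto simp: group_unblocked_def unblocked_def)
qed

text \<open>The deviation affects the own term and, through the factor \<open>1 - q i\<close>, the
  users in \<open>Iplus i\<close>. Weighted by the ties, these changes add up to a difference of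
  \<open>payoff\<close>, whatever the others play.\<close>

lemma S_upd:
  assumes i: "i \<in> {1..N}" and q: "\<And>k. k \<in> {1..N} \<Longrightarrow> q k \<in> {0..1}"
    and fin: "S q i \<noteq> - \<infinity>"
    and y: "0 < y" "y \<le> 1" "y = 1 \<Longrightarrow> tie i = 0"
  shows "S (q(i := y)) i =
    S q i + ereal (payoff (tie i) (c i) y - payoff (tie i) (c i) (q i))"
proof -
  define d where "d = ln (1 - y) - ln (1 - q i)"
  let ?R = "real_utility Iminus z c"
  have u: "group_unblocked q i" using fin S_eq[OF i q] by (auto split: if_splits)
  have u': "group_unblocked (q(i := y)) i" by (rule group_unblocked_upd[OF i u y])
  have w0: "w i j = 0" if "j \<in> Iplus i - Ns i" for j
    using that Iplus[OF i] by (intro w_eq_0[OF i]) auto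
  have "(\<Sum>j\<in>Ns i. w i j * ?R (q(i := y)) j) =
      (\<Sum>j\<in>Ns i. w i j * ?R q j + (if j \<in> Iplus i then w i j * d else 0))"
  proof (rule sum.cong[OF refl])
    fix j assume "j \<in> Ns i"
    then have jN: "j \<in> {1..N}" "j \<noteq> i" using Ns[OF i] by auto
    then show "w i j * ?R (q(i := y)) j =
        w i j * ?R q j + (if j \<in> Iplus i then w i j * d else 0)"
      using Iplus_iff[OF i jN(1)] real_utility_upd_other[of Iminus j i, OF finite_sets(2)[OF jN(1)] jN(2)]
      by (simp add: d_def algebra_simps)
  qed
  also have "\<dots> = (\<Sum>j\<in>Ns i. w i j * ?R q j) + (\<Sum>j\<in>Ns i \<inter> Iplus i. w i j * d)"
    by (simp add: sum.distrib sum.inter_restrict[OF finite_sets(3)[OF i]])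
  \<comment> \<open>Interfered users without a social tie have weight 0, so they may be added to the
    sum.\<close>
  also have "(\<Sum>j\<in>Ns i \<inter> Iplus i. w i j * d) = (\<Sum>j\<in>Iplus i. w i j * d)"
    by (intro sum.mono_neutral_left finite_sets[OF i]) (use w0 in auto)
  also have "\<dots> = tie i * d" by (simp add: sum_distrib_right)
  finally have sum_upd:
    "(\<Sum>j\<in>Ns i. w i j * ?R (q(i := y)) j) = (\<Sum>j\<in>Ns i. w i j * ?R q j) + tie i * d" .
  have "i \<notin> Iminus i" using Iminus[OF i] by blast
  moreover have "(q(i := y)) k \<in> {0..1}" if "k \<in> {1..N}" for k
    using q[OF that] y by auto
  ultimately show ?thesis
    using u u' sum_upd S_eq[OF i q] S_eq[OF i, of "q(i := y)"]
      real_utility_upd_self[of i Iminus z c q y]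
    by (simp add: payoff_def d_def algebra_simps)
qed

section \<open>Existence and uniqueness of the equilibrium\<close>

lemma sne_prob_eq: "sne_prob Iplus w c i = opt_prob (tie i) (c i)"
  by (simp add: sne_prob_def opt_prob_def)

lemma sne_prob_range:
  assumes i: "i \<in> {1..N}"
  shows "sne_prob Iplus w c i > 0" "sne_prob Iplus w c i \<le> 1"
    "sne_prob Iplus w c i = 1 \<Longrightarrow> tie i = 0"
  unfolding sne_prob_eq
  by (rule opt_prob_pos opt_prob_le_1 opt_prob_eq_1D(1), rule tie_nonneg[OF i], rule c_pos[OF i],
      assumption?)+

lemma S_less_sne_prob:
  assumes i: "i \<in> {1..N}" and q: "\<And>k. k \<in> {1..N} \<Longrightarrow> q k \<in> {0..1}"
    and fin: "S q i \<noteq> - \<infinity>" and neq: "q i \<noteq> sne_prob Iplus w c i"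
  shows "S q i < S (q(i := sne_prob Iplus w c i)) i"
proof -
  have u: "group_unblocked q i" using fin S_eq[OF i q] by (auto split: if_splits)
  have "payoff (tie i) (c i) (q i) < payoff (tie i) (c i) (sne_prob Iplus w c i)"
    using q[OF i] neq unfolding sne_prob_eq
    by (intro payoff_less_opt_prob tie_nonneg c_pos i group_unblocked_own[OF i u]) auto
  \<comment> \<open>A positive gain is a strict increase in \<open>ereal\<close> only from a real
    starting value.\<close>
  moreover obtain r where "S q i = ereal r" using u S_eq[OF i q] by auto
  ultimately show ?thesis using S_upd[OF i q fin sne_prob_range[OF i]] by simp
qed

lemma is_SNE_sne_prob: "is_SNE N Iminus Ns w z c (sne_prob Iplus w c)"
  unfolding is_SNE_def
proof (intro ballI conjI)
  let ?p = "sne_prob Iplus w c"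
  have p: "?p k \<in> {0..1}" if "k \<in> {1..N}" for k
    using sne_prob_range[OF that] by simp
  fix i assume i: "i \<in> {1..N}"
  show "?p i \<in> {0..1}" by (rule p[OF i])
  fix x :: real assume x: "x \<in> {0..1}"
  have "(?p(i := x)) k \<in> {0..1}" if "k \<in> {1..N}" for k
    using p[OF that] x by simp
  \<comment> \<open>Strict dominance is applied at the deviated profile: moving user
    \<open>i\<close> back to \<open>?p i\<close> improves a finite utility. A deviation with utility
    -\<infinity> is trivially no better.\<close>
  then have "S (?p(i := x)) i < S ?p i" if "S (?p(i := x)) i \<noteq> - \<infinity>" "x \<noteq> ?p i"
    using S_less_sne_prob[OF i, of "?p(i := x)"] that by simp
  then show "S (?p(i := x)) i \<le> S ?p i"
    by (cases "S (?p(i := x)) i = - \<infinity>"; cases "x = ?p i") auto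
qed

text \<open>Otherwise switching to the dominant choice would be a profitable deviation. Finiteness
  excludes blocked equilibria such as those in \<open>SNE_not_unique\<close>.\<close>

lemma is_SNE_unique:
  assumes sne: "is_SNE N Iminus Ns w z c q" and i: "i \<in> {1..N}" and fin: "S q i \<noteq> - \<infinity>"
  shows "q i = sne_prob Iplus w c i"
proof (rule ccontr)
  assume "q i \<noteq> sne_prob Iplus w c i"
  then have "S q i < S (q(i := sne_prob Iplus w c i)) i"
    using sne by (intro S_less_sne_prob i fin) (auto simp: is_SNE_def)
  moreover have "S (q(i := sne_prob Iplus w c i)) i \<le> S q i"
    using sne i sne_prob_range[OF i] by (simp add: is_SNE_def)
  ultimately show False by simp
qed

end

theorem theorem8:
  fixes N :: nat
    and Iplus Iminus Ns :: "nat \<Rightarrow> nat set"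
    and w :: "nat \<Rightarrow> nat \<Rightarrow> real"
    and z c :: "nat \<Rightarrow> real"
  assumes "\<And>i. i \<in> {1..N} \<Longrightarrow> Iplus i \<subseteq> {1..N} - {i}"
    and "\<And>i. i \<in> {1..N} \<Longrightarrow> Iminus i \<subseteq> {1..N} - {i}"
    and "\<And>i j. i \<in> {1..N} \<Longrightarrow> j \<in> {1..N} \<Longrightarrow> j \<in> Iplus i \<longleftrightarrow> i \<in> Iminus j"
    and "\<And>i. i \<in> {1..N} \<Longrightarrow> z i > 0"
    and "\<And>i. i \<in> {1..N} \<Longrightarrow> c i > 0"
    and "\<And>i. i \<in> {1..N} \<Longrightarrow> Ns i \<subseteq> {1..N} - {i}"
    and "\<And>i j. i \<in> {1..N} \<Longrightarrow> j \<in> {1..N} - {i} \<Longrightarrow> w i j \<in> {0..1}"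
    and "\<And>i j. i \<in> {1..N} \<Longrightarrow> j \<in> {1..N} - {i} \<Longrightarrow> j \<notin> Ns i \<Longrightarrow> w i j = 0"
  shows "is_SNE N Iminus Ns w z c (sne_prob Iplus w c) \<and>
         (\<forall>q. is_SNE N Iminus Ns w z c q \<longrightarrow>
            (\<forall>i\<in>{1..N}. social_group_utility Iminus Ns w z c q i \<noteq> - \<infinity> \<longrightarrow> q i = sne_prob Iplus w c i))"
proof -
  interpret access_game N Iplus Iminus Ns w z c
    using assms by unfold_locales auto
  show ?thesis using is_SNE_sne_prob is_SNE_unique by blast
qed

end
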